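(* Let $H$ be a nonempty graph of order $n'$ and let $n\ge 2$ be an integer. If $\gamma_{\rm sp}(H)=n'-1$ and $H\not\cong K_{n'}$, then $$\gamma_{\rm sp}(P_n\circ H)=nn'-\left\lceil\frac{2n}{3}\right\rceil.$$ Furthermore, if $\gamma_{\rm sp}(H)\le n'-2$, then $$\gamma_{\rm sp}(P_n\circ H)=\left\lceil\frac{n}{2}\right\rceil\gamma_{\rm sp}(H)+n'\left\lfloor\frac{n}{2}\right\rfloor.$$
   Context: All graphs are finite, simple and undirected; the order of a graph is its number of vertices. A nonempty graph is one with at least one edge. $K_m$ and $P_m$ are the complete graph and the path of order $m$ (i.e. on $m$ vertices). For a vertex $v$ of $G$, $N(v)$ is the set of vertices adjacent to $v$, and for $D\subseteq V(G)$, $\overline{D}=V(G)\setminus D$. A set $D\subseteq V(G)$ is a super dominating set of $G$ if for every $u\in\overline{D}$ there exists $v\in D$ such that $N(v)\cap\overline{D}=\{u\}$. The super domination number $\gamma_{\rm sp}(G)$ is the minimum cardinality of a super dominating set of $G$. The lexicographic product $G\circ H$ has vertex set $V(G)\times V(H)$, and $(g,h)$ is adjacent to $(g',h')$ if and only if $gg'\in E(G)$, or $g=g'$ and $hh'\in E(H)$. *)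

theory Defs
  imports Complex_Main "Graph_Theory.Graph_Theory"
begin

(* A finite simple undirected graph is a pair_graph: a finite vertex set together with a
   symmetric, irreflexive set of ordered pairs, each edge contributing both orientations. *)

definition neighbourhood :: "'a pair_pre_digraph \<Rightarrow> 'a \<Rightarrow> 'a set" where
  "neighbourhood G v = {w. (v, w) \<in> parcs G}"

definition super_dominating :: "'a pair_pre_digraph \<Rightarrow> 'a set \<Rightarrow> bool" where
  "super_dominating G D \<longleftrightarrow>
     D \<subseteq> pverts G \<and>
     (\<forall>u \<in> pverts G - D. \<exists>v \<in> D. neighbourhood G v \<inter> (pverts G - D) = {u})"

(* The minimum always exists, see super_dominating_pverts. *)
definition super_domination_number :: "'a pair_pre_digraph \<Rightarrow> nat" where
  "super_domination_number G = (LEAST k. \<exists>D. super_dominating G D \<and> card D = k)"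

definition path_graph :: "nat \<Rightarrow> nat pair_pre_digraph" where
  "path_graph n =
     \<lparr>pverts = {..<n},
      parcs = {(i, j). i < n \<and> j < n \<and> (j = Suc i \<or> i = Suc j)}\<rparr>"

definition lex_product ::
    "'a pair_pre_digraph \<Rightarrow> 'b pair_pre_digraph \<Rightarrow> ('a \<times> 'b) pair_pre_digraph" where
  "lex_product G H =
     \<lparr>pverts = pverts G \<times> pverts H,
      parcs = {((g, h), (g', h')).
        (g, h) \<in> pverts G \<times> pverts H \<and> (g', h') \<in> pverts G \<times> pverts H \<and>
        ((g, g') \<in> parcs G \<or> (g = g' \<and> (h, h') \<in> parcs H))}\<rparr>"

lemma super_dominating_pverts: "super_dominating G (pverts G)"
  by (simp add: super_dominating_def)

lemma pair_graph_path_graph: "pair_graph (path_graph n)"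
proof -
  have "parcs (path_graph n) \<subseteq> {..<n} \<times> {..<n}"
    by (auto simp: path_graph_def)
  then have "finite (parcs (path_graph n))"
    by (rule finite_subset) simp
  then show ?thesis
    by unfold_locales (auto simp: path_graph_def symmetric_def sym_def)
qed

lemma pair_graph_lex_product:
  assumes "pair_graph G" and "pair_graph H"
  shows "pair_graph (lex_product G H)"
proof -
  interpret G: pair_graph G by fact
  interpret H: pair_graph H by fact
  have fin: "finite (pverts G \<times> pverts H)"
    using G.pair_finite_verts H.pair_finite_verts by simp
  have "parcs (lex_product G H) \<subseteq> (pverts G \<times> pverts H) \<times> (pverts G \<times> pverts H)"
    by (auto simp: lex_product_def)
  then have finarcs: "finite (parcs (lex_product G H))"
    by (rule finite_subset) (use fin in simp)
  have symG: "(b, a) \<in> parcs G" if "(a, b) \<in> parcs G" for a b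
    using G.pair_sym_arcs that by (auto simp: symmetric_def dest: symD)
  have symH: "(b, a) \<in> parcs H" if "(a, b) \<in> parcs H" for a b
    using H.pair_sym_arcs that by (auto simp: symmetric_def dest: symD)
  show ?thesis
    using finarcs fin
    by unfold_locales
      (auto simp: lex_product_def symmetric_def sym_def
        dest: symG symH G.pair_no_loops H.pair_no_loops)
qed

end

theory Submission
  imports Defs
begin

text \<open>
  Passing to complements turns the problem into a maximisation: a set \<open>D\<close> is super dominating iff
  every vertex \<open>u\<close> of its complement \<open>U\<close> has a private neighbour, a vertex \<open>v\<close> outside \<open>U\<close> whose only
  neighbour in \<open>U\<close> is \<open>u\<close>. Call such a \<open>U\<close> privately dominated. Writing \<open>k\<close> for the largest size of
  such a set in \<open>H\<close>, which is \<open>n'\<close> minus the super domination number, the two claims say that the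
  largest one in \<open>P\<^sub>n \<circ> H\<close> has \<open>\<lceil>2n/3\<rceil>\<close> elements if \<open>k = 1\<close> and \<open>H\<close> is not complete, and
  \<open>\<lceil>n/2\<rceil> k\<close> elements if \<open>k \<ge> 2\<close>.

  A vertex \<open>(j, h)\<close> of the product sees all of the layers next to layer \<open>j\<close>. Hence a private
  neighbour of \<open>(i, x)\<close> is of one of two kinds (\<open>privately_dominated_lex_product_cases\<close>): it lies in
  layer \<open>i\<close>, and then the layers next to \<open>i\<close> do not meet \<open>U\<close>; or it lies in a layer \<open>j\<close> next to \<open>i\<close>,
  and then \<open>(i, x)\<close> is the only element of \<open>U\<close> in all layers next to \<open>j\<close>. So a layer with at least two
  elements of \<open>U\<close> has empty neighbouring layers and is itself privately dominated in \<open>H\<close>.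

  If \<open>k \<ge> 2\<close>, every layer therefore has at most \<open>k\<close> elements, and two consecutive layers have at most
  \<open>k\<close> together: one of them is empty, or both are singletons. Pairing up the layers gives the upper
  bound \<open>\<lceil>n/2\<rceil> k\<close>; a maximum set of \<open>H\<close> in every other layer attains it.

  If \<open>k = 1\<close>, every layer has at most one element, so only the set \<open>A\<close> of nonempty layers counts.
  When \<open>i\<close>, \<open>i + 1\<close> and \<open>i + 2\<close> are in \<open>A\<close>, the private neighbour for layer \<open>i\<close> can only be in layer
  \<open>i - 1\<close>, which must exist, and \<open>i - 2\<close> is not in \<open>A\<close>. This alone forces \<open>3 |A| \<le> 2n + 2\<close>
  (\<open>card_le_two_thirds\<close>). Conversely, repeating the pattern nonempty, nonempty, empty along the path
  attains the bound, provided that the layers hold a vertex \<open>x\<close> of \<open>H\<close> that has both a neighbour, needed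
  when the last layer of the path is an isolated one, and a non-neighbour, needed when two consecutive
  layers serve each other. Such an \<open>x\<close> exists in every nonempty graph that is not complete.
\<close>

section \<open>Private domination\<close>

definition privately_dominated :: "'a pair_pre_digraph \<Rightarrow> 'a set \<Rightarrow> bool" where
  "privately_dominated G U \<longleftrightarrow>
     U \<subseteq> pverts G \<and> (\<forall>u \<in> U. \<exists>v \<in> pverts G - U. neighbourhood G v \<inter> U = {u})"

lemma super_dominating_iff_privately_dominated:
  assumes "D \<subseteq> pverts G"
  shows "super_dominating G D \<longleftrightarrow> privately_dominated G (pverts G - D)"
proof -
  have "pverts G - (pverts G - D) = D" using assms by auto
  then show ?thesis
    using assms by (simp add: super_dominating_def privately_dominated_def)
qed

lemma card_add_super_domination_number_le:
  assumes "finite (pverts G)" and "privately_dominated G U"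
  shows "card U + super_domination_number G \<le> card (pverts G)"
proof -
  have U: "U \<subseteq> pverts G" using assms(2) by (simp add: privately_dominated_def)
  then have "pverts G - (pverts G - U) = U" by auto
  then have "super_dominating G (pverts G - U)"
    using assms(2) by (simp add: super_dominating_iff_privately_dominated)
  then have "super_domination_number G \<le> card (pverts G - U)"
    unfolding super_domination_number_def by (intro Least_le) blast
  moreover have "card (pverts G - U) + card U = card (pverts G)"
    using U assms(1) by (metis card_Diff_subset card_mono finite_subset le_add_diff_inverse2)
  ultimately show ?thesis by linarith
qed

lemma ex_maximum_privately_dominated:
  assumes "finite (pverts G)"
  obtains U where "privately_dominated G U"
    and "card U + super_domination_number G = card (pverts G)"
proof -
  have "\<exists>k D. super_dominating G D \<and> card D = k"
    using super_dominating_pverts by blast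
  then have "\<exists>D. super_dominating G D \<and> card D = super_domination_number G"
    unfolding super_domination_number_def by (rule LeastI_ex)
  then obtain D where D: "super_dominating G D" "card D = super_domination_number G"
    by blast
  have sub: "D \<subseteq> pverts G" using D(1) by (simp add: super_dominating_def)
  show thesis
  proof
    show "privately_dominated G (pverts G - D)"
      using D(1) sub by (simp add: super_dominating_iff_privately_dominated)
    show "card (pverts G - D) + super_domination_number G = card (pverts G)"
      using D(2) sub assms
      by (metis card_Diff_subset card_mono finite_subset le_add_diff_inverse2)
  qed
qed

section \<open>Layers of a lexicographic product\<close>

lemma neighbourhood_path_graph:
  "neighbourhood (path_graph n) i = {j. i < n \<and> j < n \<and> (j = Suc i \<or> i = Suc j)}"
  by (auto simp: neighbourhood_def path_graph_def)

lemma neighbourhood_lex_product: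
  assumes "pair_graph G" and "pair_graph H" and "g \<in> pverts G" and "h \<in> pverts H"
  shows "neighbourhood (lex_product G H) (g, h) =
    neighbourhood G g \<times> pverts H \<union> {g} \<times> neighbourhood H h"
proof -
  interpret G: pair_graph G by fact
  interpret H: pair_graph H by fact
  show ?thesis
    using assms(3,4) by (auto simp: neighbourhood_def lex_product_def
      dest: G.in_arcsD1 G.in_arcsD2 H.in_arcsD1 H.in_arcsD2)
qed

lemma not_in_own_neighbourhood: "pair_graph G \<Longrightarrow> v \<notin> neighbourhood G v"
  unfolding pair_graph_def pair_digraph_def neighbourhood_def
  by (auto dest: pair_loopfree_digraph.pair_no_loops)

text \<open>
  All upper bounds rest on this dichotomy. A vertex in layer \<open>j\<close> is adjacent to all of each layer next
  to \<open>j\<close>, so being private to a single element of \<open>U\<close> empties those layers, with the possible exception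
  of that one element.
\<close>

lemma privately_dominated_lex_product_cases:
  assumes G: "pair_graph G" and H: "pair_graph H"
    and U: "privately_dominated (lex_product G H) U" and u: "(i, x) \<in> U"
  obtains (inside) h where "h \<in> pverts H - U `` {i}" "neighbourhood H h \<inter> U `` {i} = {x}"
      "\<And>j. j \<in> neighbourhood G i \<Longrightarrow> U `` {j} = {}"
  | (outside) j where "i \<in> neighbourhood G j" "U `` {i} = {x}"
      "\<And>l. l \<in> neighbourhood G j \<Longrightarrow> l \<noteq> i \<Longrightarrow> U `` {l} = {}"
proof -
  have sub: "U \<subseteq> pverts G \<times> pverts H"
    using U by (simp add: privately_dominated_def lex_product_def)
  have "\<exists>v \<in> pverts (lex_product G H) - U. neighbourhood (lex_product G H) v \<inter> U = {(i, x)}"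
    using U u by (auto simp: privately_dominated_def)
  then obtain j h where v: "j \<in> pverts G" "h \<in> pverts H" "(j, h) \<notin> U"
    and eq: "neighbourhood (lex_product G H) (j, h) \<inter> U = {(i, x)}"
    by (auto simp: lex_product_def)
  have nbh: "neighbourhood (lex_product G H) (j, h) =
      neighbourhood G j \<times> pverts H \<union> {j} \<times> neighbourhood H h"
    by (rule neighbourhood_lex_product[OF G H v(1,2)])
  have "(i, x) \<in> neighbourhood (lex_product G H) (j, h)" using eq by blast
  then have near: "i \<in> neighbourhood G j \<or> i = j \<and> x \<in> neighbourhood H h"
    unfolding nbh by blast
  have only: "a = i \<and> b = x"
    if "(a, b) \<in> U" "a \<in> neighbourhood G j \<or> a = j \<and> b \<in> neighbourhood H h" for a b
  proof -
    have "b \<in> pverts H" using that(1) sub by blast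
    then have "(a, b) \<in> neighbourhood (lex_product G H) (j, h) \<inter> U"
      using that unfolding nbh by blast
    then show ?thesis unfolding eq by simp
  qed
  have loop: "j \<notin> neighbourhood G j" using G by (rule not_in_own_neighbourhood)
  show thesis
  proof (cases "j = i")
    case True
    show ?thesis
    proof (rule inside)
      show "h \<in> pverts H - U `` {i}" using v True by blast
      show "neighbourhood H h \<inter> U `` {i} = {x}" using near only loop True u by blast
      show "U `` {l} = {}" if "l \<in> neighbourhood G i" for l
        using only loop True that by blast
    qed
  next
    case False
    then have i: "i \<in> neighbourhood G j" using near by blast
    show ?thesis
    proof (rule outside[OF i])
      show "U `` {i} = {x}" using only i u by blast
      show "U `` {l} = {}" if "l \<in> neighbourhood G j" "l \<noteq> i" for l
        using only that by blast
    qed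
  qed
qed

text \<open>
  The second alternative of the dichotomy makes the layer a singleton, so all elements of a larger
  layer have their private neighbours within it.
\<close>

lemma large_layer:
  assumes G: "pair_graph G" and H: "pair_graph H"
    and U: "privately_dominated (lex_product G H) U" and two: "2 \<le> card (U `` {i})"
  shows "privately_dominated H (U `` {i})"
    and "j \<in> neighbourhood G i \<Longrightarrow> U `` {j} = {}"
proof -
  have sub: "U `` {i} \<subseteq> pverts H"
    using U by (auto simp: privately_dominated_def lex_product_def)
  have ins: "(\<exists>h \<in> pverts H - U `` {i}. neighbourhood H h \<inter> U `` {i} = {x}) \<and>
      (\<forall>j \<in> neighbourhood G i. U `` {j} = {})" if "(i, x) \<in> U" for x
    using G H U that
  proof (cases rule: privately_dominated_lex_product_cases)
    case (outside j)
    then show ?thesis using two by simp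
  qed blast
  show "privately_dominated H (U `` {i})"
    using conjunct1[OF ins] sub unfolding privately_dominated_def by blast
  have "U `` {i} \<noteq> {}" using two by auto
  then obtain x where "(i, x) \<in> U" by auto
  then have "\<forall>j \<in> neighbourhood G i. U `` {j} = {}" by (rule conjunct2[OF ins])
  then show "U `` {j} = {}" if "j \<in> neighbourhood G i" using that by (rule bspec)
qed

section \<open>Upper bounds\<close>

lemma card_eq_sum_layers:
  assumes "U \<subseteq> I \<times> B" and "finite I" and "finite B"
  shows "card U = (\<Sum>i\<in>I. card (U `` {i}))"
proof -
  have "finite (U `` {i})" for i
    by (rule finite_subset[OF _ assms(3)]) (use assms(1) in auto)
  then have "card (SIGMA i:I. U `` {i}) = (\<Sum>i\<in>I. card (U `` {i}))"
    using assms(2) by (simp add: card_SigmaI)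
  moreover have "(SIGMA i:I. U `` {i}) = U" using assms(1) by auto
  ultimately show ?thesis by simp
qed

lemma sum_le_of_consecutive_pairs:
  fixes f :: "nat \<Rightarrow> nat"
  assumes "\<And>i. i < n \<Longrightarrow> f i \<le> k" and "\<And>i. Suc i < n \<Longrightarrow> f i + f (Suc i) \<le> k"
  shows "(\<Sum>i<n. f i) \<le> (Suc n div 2) * k"
  using assms
proof (induction n rule: induct_nat_012)
  case (ge2 n)
  have "(\<Sum>i<n. f i) \<le> (Suc n div 2) * k" by (rule ge2.IH(1)) (use ge2.prems in auto)
  moreover have "f n + f (Suc n) \<le> k" using ge2.prems(2)[of n] by simp
  ultimately show ?case by simp
qed auto

text \<open>
  The bound says that elements of \<open>A\<close> are at most twice as many as the gaps in \<open>{..n}\<close>, where \<open>n\<close>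
  counts as an additional gap that closes the last run. Each element is charged to a nearby gap: the
  last two elements of every run to the gap after the run, and all other elements to the gap before it.
  By the hypothesis, a run has at most four elements, so no gap is charged more than twice from
  one side. A gap charged from its right precedes a run of at least three, hence is position 0 or
  follows another gap, and is therefore not charged from its left.
\<close>

lemma card_le_two_thirds:
  fixes A :: "nat set"
  assumes A: "A \<subseteq> {..<n}"
    and run: "\<And>i. \<lbrakk>i \<in> A; i + 1 \<in> A; i + 2 \<in> A\<rbrakk> \<Longrightarrow> 1 \<le> i \<and> (2 \<le> i \<longrightarrow> i - 2 \<notin> A)"
  shows "3 * card A \<le> 2 * n + 2"
proof -
  define c where "c i = (if i + 1 \<notin> A then i + 1 else if i + 2 \<notin> A then i + 2
    else if i - 1 \<notin> A then i - 1 else i - 2)" for i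
  have fin: "finite A" using A finite_subset by blast
  have c_gap: "c i \<in> {..n} - A" if i: "i \<in> A" for i
  proof -
    have "i < n" "i + 1 \<in> A \<Longrightarrow> i + 1 < n" using A i by auto
    moreover have "i - 2 \<notin> A" if "i + 1 \<in> A" "i + 2 \<in> A" "i - 1 \<in> A"
      using run[of i] run[of "i - 1"] i that by (cases i) auto
    ultimately show ?thesis by (auto simp: c_def)
  qed
  \<comment> \<open>If the position before \<open>z\<close> is in \<open>A\<close>, the run after \<open>z\<close> has at most two elements, and
    these are charged to the right; otherwise nothing to the left of \<open>z\<close> is charged to \<open>z\<close>.\<close>
  have fibre: "card {i \<in> A. c i = z} \<le> 2" if z: "z \<notin> A" for z
  proof (cases "1 \<le> z \<and> z - 1 \<in> A")
    case True
    have "{i \<in> A. c i = z} \<subseteq> {z - 1, z - 2}"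
    proof
      fix i assume "i \<in> {i \<in> A. c i = z}"
      then have i: "i \<in> A" "c i = z" by auto
      have "i < z"
      proof (rule ccontr)
        assume "\<not> i < z"
        then have up: "i + 1 \<in> A" "i + 2 \<in> A"
          using i by (auto simp: c_def split: if_splits)
        show False
        proof (cases "i - 1 \<in> A")
          case False
          then have "i - 1 = z" using i up by (simp add: c_def)
          moreover have "i \<noteq> 0" using False i(1) by (metis diff_0_eq_0)
          ultimately have "i = z + 1" by linarith
          then show ?thesis using run[of i] i(1) up True by auto
        next
          case down: True
          then have "i - 2 = z" using i up by (simp add: c_def)
          moreover from this have "i \<noteq> 0" using z i(1) by (metis diff_0_eq_0)
          moreover from \<open>i - 2 = z\<close> have "i \<noteq> 1" using z down by auto
          ultimately have "i = z + 2" by linarith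
          then show ?thesis using run[of "i - 1"] i(1) up down True by auto
        qed
      qed
      then show "i \<in> {z - 1, z - 2}"
        using i by (auto simp: c_def split: if_splits)
    qed
    then have "card {i \<in> A. c i = z} \<le> card {z - 1, z - 2}" by (intro card_mono) auto
    also have "\<dots> \<le> 2" by (simp add: card_insert_if)
    finally show ?thesis .
  next
    case False
    have "{i \<in> A. c i = z} \<subseteq> {z + 1, z + 2}"
    proof
      fix i assume "i \<in> {i \<in> A. c i = z}"
      then have i: "i \<in> A" "c i = z" by auto
      have "\<not> i < z" using i False by (auto simp: c_def split: if_splits)
      moreover have "i \<noteq> z" using i(1) z by blast
      moreover have "i \<le> c i + 2" by (auto simp: c_def)
      ultimately show "i \<in> {z + 1, z + 2}" using i(2) by auto
    qed
    then have "card {i \<in> A. c i = z} \<le> card {z + 1, z + 2}" by (intro card_mono) auto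
    then show ?thesis by simp
  qed
  have "card A = (\<Sum>z\<in>{..n} - A. card {i \<in> A. c i = z})"
    using sum.group[of A "{..n} - A" c "\<lambda>_. 1::nat"] fin c_gap by (auto simp: image_subset_iff)
  also have "\<dots> \<le> (\<Sum>z\<in>{..n} - A. 2)" by (intro sum_mono fibre) auto
  also have "\<dots> = 2 * (Suc n - card A)"
    using card_Diff_subset[OF fin, of "{..n}"] A by (auto simp: subset_iff less_imp_le)
  finally have "card A \<le> 2 * (Suc n - card A)" .
  then show ?thesis by (cases "card A \<le> Suc n") auto
qed

text \<open>
  For maximum size 1 in \<open>H\<close>, no layer can be large, so the count reduces to the set of nonempty layers.
\<close>

lemma three_mult_card_le_path_lex_product:
  assumes H: "pair_graph H" and one: "super_domination_number H + 1 = card (pverts H)"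
    and U: "privately_dominated (lex_product (path_graph n) H) U"
  shows "3 * card U \<le> 2 * n + 2"
proof -
  interpret H: pair_graph H by fact
  note P = pair_graph_path_graph[of n]
  have sub: "U \<subseteq> {..<n} \<times> pverts H"
    using U by (simp add: privately_dominated_def lex_product_def path_graph_def)
  define A where "A = {i. i < n \<and> U `` {i} \<noteq> {}}"
  have layer: "card (U `` {i}) \<le> 1" for i
  proof (rule ccontr)
    assume "\<not> card (U `` {i}) \<le> 1"
    then have "2 \<le> card (U `` {i})" by simp
    moreover from this have "privately_dominated H (U `` {i})" by (rule large_layer(1)[OF P H U])
    ultimately show False
      using card_add_super_domination_number_le[OF H.pair_finite_verts] one by fastforce
  qed
  have "card U = (\<Sum>i<n. card (U `` {i}))"
    using sub H.pair_finite_verts by (intro card_eq_sum_layers) auto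
  also have "\<dots> \<le> (\<Sum>i<n. if i \<in> A then 1 else 0)"
    using layer by (intro sum_mono) (auto simp: A_def)
  also have "\<dots> = card A"
    by (simp add: A_def flip: sum.inter_filter)
  finally have "card U \<le> card A" .
  moreover have "3 * card A \<le> 2 * n + 2"
  proof (rule card_le_two_thirds)
    show "A \<subseteq> {..<n}" by (auto simp: A_def)
    fix i assume i: "i \<in> A" "i + 1 \<in> A" "i + 2 \<in> A"
    then obtain x where "(i, x) \<in> U" by (auto simp: A_def)
    with P H U show "1 \<le> i \<and> (2 \<le> i \<longrightarrow> i - 2 \<notin> A)"
    proof (cases rule: privately_dominated_lex_product_cases)
      case (inside h)
      then show ?thesis
        using inside(3)[of "i + 1"] i by (auto simp: A_def neighbourhood_path_graph)
    next
      case (outside j)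
      have "j \<noteq> i + 1"
        using outside(3)[of "i + 2"] i by (auto simp: A_def neighbourhood_path_graph)
      then have "i = j + 1" using outside(1) by (auto simp: neighbourhood_path_graph)
      then show ?thesis
        using outside(3)[of "i - 2"] outside(1) by (auto simp: A_def neighbourhood_path_graph)
    qed
  qed
  ultimately show ?thesis by linarith
qed

text \<open>
  Two consecutive nonempty layers are both singletons, which is harmless exactly because \<open>2 \<le> k\<close>.
\<close>

lemma card_le_path_lex_product:
  assumes H: "pair_graph H" and k: "super_domination_number H + k = card (pverts H)" "2 \<le> k"
    and U: "privately_dominated (lex_product (path_graph n) H) U"
  shows "card U \<le> (Suc n div 2) * k"
proof -
  interpret H: pair_graph H by fact
  note P = pair_graph_path_graph[of n]
  have sub: "U \<subseteq> {..<n} \<times> pverts H"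
    using U by (simp add: privately_dominated_def lex_product_def path_graph_def)
  have layer: "card (U `` {i}) \<le> k" for i
  proof (cases "2 \<le> card (U `` {i})")
    case True
    then have "privately_dominated H (U `` {i})" by (rule large_layer(1)[OF P H U])
    then show ?thesis
      using card_add_super_domination_number_le[OF H.pair_finite_verts] k by fastforce
  qed (use k in simp)
  have "card (U `` {i}) + card (U `` {Suc i}) \<le> k" if "Suc i < n" for i
  proof -
    have "U `` {Suc i} = {}" if "2 \<le> card (U `` {i})"
      using large_layer(2)[OF P H U that, of "Suc i"] \<open>Suc i < n\<close>
      by (simp add: neighbourhood_path_graph)
    moreover have "U `` {i} = {}" if "2 \<le> card (U `` {Suc i})"
      using large_layer(2)[OF P H U that, of i] \<open>Suc i < n\<close>
      by (simp add: neighbourhood_path_graph)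
    ultimately consider "U `` {Suc i} = {}" | "U `` {i} = {}"
      | "card (U `` {i}) \<le> 1" "card (U `` {Suc i}) \<le> 1"
      by linarith
    then show ?thesis
      using layer[of i] layer[of "Suc i"] k(2) by cases auto
  qed
  then have "(\<Sum>i<n. card (U `` {i})) \<le> (Suc n div 2) * k"
    by (intro sum_le_of_consecutive_pairs layer)
  moreover have "card U = (\<Sum>i<n. card (U `` {i}))"
    using sub H.pair_finite_verts by (intro card_eq_sum_layers) auto
  ultimately show ?thesis by simp
qed

section \<open>Constructions\<close>

lemma privately_dominated_lex_product_independent:
  assumes G: "pair_graph G" and H: "pair_graph H"
    and S: "S \<subseteq> pverts G" "\<And>i. i \<in> S \<Longrightarrow> neighbourhood G i \<inter> S = {}"
    and W: "privately_dominated H W"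
  shows "privately_dominated (lex_product G H) (S \<times> W)"
  unfolding privately_dominated_def
proof (intro conjI ballI)
  show "S \<times> W \<subseteq> pverts (lex_product G H)"
    using S(1) W by (auto simp: lex_product_def privately_dominated_def)
  fix u assume "u \<in> S \<times> W"
  then obtain i x where u: "u = (i, x)" "i \<in> S" "x \<in> W" by auto
  obtain h where h: "h \<in> pverts H - W" "neighbourhood H h \<inter> W = {x}"
    using W u(3) by (auto simp: privately_dominated_def)
  have i: "i \<in> pverts G" using S(1) u(2) by auto
  show "\<exists>v \<in> pverts (lex_product G H) - S \<times> W.
      neighbourhood (lex_product G H) v \<inter> S \<times> W = {u}"
  proof
    show "(i, h) \<in> pverts (lex_product G H) - S \<times> W"
      using i h(1) by (auto simp: lex_product_def)
    have "neighbourhood (lex_product G H) (i, h) =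
        neighbourhood G i \<times> pverts H \<union> {i} \<times> neighbourhood H h"
      using h(1) by (intro neighbourhood_lex_product[OF G H i]) simp
    then have "neighbourhood (lex_product G H) (i, h) \<inter> S \<times> W =
        (neighbourhood G i \<inter> S) \<times> (pverts H \<inter> W) \<union> ({i} \<inter> S) \<times> (neighbourhood H h \<inter> W)"
      by auto
    also have "\<dots> = {u}" using S(2)[OF u(2)] h(2) u by simp
    finally show "neighbourhood (lex_product G H) (i, h) \<inter> S \<times> W = {u}" .
  qed
qed

text \<open>
  A neighbour \<open>w\<close> of \<open>x\<close> serves as private neighbour within a layer. It would not do in a layer next to
  another nonempty one; there a layer \<open>j\<close> with exactly one neighbour in \<open>S\<close> serves, and as \<open>j\<close> may itself
  be in \<open>S\<close>, its private neighbour has to be a non-neighbour \<open>y\<close> of \<open>x\<close>.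
\<close>

lemma privately_dominated_lex_product_singleton_layers:
  assumes G: "pair_graph G" and H: "pair_graph H"
    and S: "S \<subseteq> pverts G"
      "\<And>i. i \<in> S \<Longrightarrow> neighbourhood G i \<inter> S = {} \<or>
        (\<exists>j \<in> pverts G. neighbourhood G j \<inter> S = {i})"
    and x: "x \<in> pverts H" "w \<in> pverts H" "x \<in> neighbourhood H w"
    and y: "y \<in> pverts H" "y \<noteq> x" "x \<notin> neighbourhood H y"
  shows "privately_dominated (lex_product G H) (S \<times> {x})"
  unfolding privately_dominated_def
proof (intro conjI ballI)
  show "S \<times> {x} \<subseteq> pverts (lex_product G H)"
    using S(1) x(1) by (auto simp: lex_product_def)
  fix u assume "u \<in> S \<times> {x}"
  then obtain i where u: "u = (i, x)" "i \<in> S" by auto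
  have i: "i \<in> pverts G" using S(1) u(2) by auto
  have w: "w \<noteq> x" using not_in_own_neighbourhood[OF H] x(3) by blast
  from S(2)[OF u(2)]
  show "\<exists>v \<in> pverts (lex_product G H) - S \<times> {x}.
      neighbourhood (lex_product G H) v \<inter> S \<times> {x} = {u}"
  proof
    assume iso: "neighbourhood G i \<inter> S = {}"
    show ?thesis
    proof
      show "(i, w) \<in> pverts (lex_product G H) - S \<times> {x}"
        using i x(2) w by (auto simp: lex_product_def)
      have "neighbourhood (lex_product G H) (i, w) \<inter> S \<times> {x} =
          (neighbourhood G i \<inter> S) \<times> (pverts H \<inter> {x}) \<union> ({i} \<inter> S) \<times> (neighbourhood H w \<inter> {x})"
        unfolding neighbourhood_lex_product[OF G H i x(2)] by auto
      also have "\<dots> = {u}" using iso u x by simp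
      finally show "neighbourhood (lex_product G H) (i, w) \<inter> S \<times> {x} = {u}" .
    qed
  next
    assume "\<exists>j \<in> pverts G. neighbourhood G j \<inter> S = {i}"
    then obtain j where j: "j \<in> pverts G" "neighbourhood G j \<inter> S = {i}" by blast
    show ?thesis
    proof
      show "(j, y) \<in> pverts (lex_product G H) - S \<times> {x}"
        using j(1) y by (auto simp: lex_product_def)
      have "neighbourhood (lex_product G H) (j, y) \<inter> S \<times> {x} =
          (neighbourhood G j \<inter> S) \<times> (pverts H \<inter> {x}) \<union> ({j} \<inter> S) \<times> (neighbourhood H y \<inter> {x})"
        unfolding neighbourhood_lex_product[OF G H j(1) y(1)] by auto
      also have "\<dots> = {u}" using j(2) u x(1) y(3) by simp
      finally show "neighbourhood (lex_product G H) (j, y) \<inter> S \<times> {x} = {u}" .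
    qed
  qed
qed

text \<open>
  Otherwise every vertex with a neighbour is adjacent to all other vertices. One edge then gives every
  vertex a neighbour, and the graph is complete.
\<close>

lemma ex_vertex_neither_isolated_nor_universal:
  assumes H: "pair_graph H" and edge: "parcs H \<noteq> {}"
    and incomplete: "\<not> complete_digraph (card (pverts H)) (with_proj H)"
  obtains x w y where "x \<in> pverts H" "w \<in> pverts H" "x \<in> neighbourhood H w"
    "y \<in> pverts H" "y \<noteq> x" "x \<notin> neighbourhood H y"
proof -
  interpret H: pair_graph H by fact
  have sym: "(b, a) \<in> parcs H" if "(a, b) \<in> parcs H" for a b
    using H.pair_sym_arcs that by (auto simp: symmetric_def dest: symD)
  have noloop: "(a, a) \<notin> parcs H" for a
    using H.pair_no_loops[of "(a, a)"] by auto
  have "\<exists>x w y. (w, x) \<in> parcs H \<and> x \<in> pverts H \<and> y \<in> pverts H \<and> y \<noteq> x \<and> (y, x) \<notin> parcs H"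
  proof (rule ccontr)
    assume "\<not> ?thesis"
    then have universal: "(y, x) \<in> parcs H"
      if "(w, x) \<in> parcs H" "y \<in> pverts H" "y \<noteq> x" for x w y
      using that H.in_arcsD2 by blast
    obtain a b where ab: "(a, b) \<in> parcs H" using edge by auto
    have "(y, x) \<in> parcs H" if "x \<in> pverts H" "y \<in> pverts H" "y \<noteq> x" for x y
    proof (cases "x = b")
      case False
      then have "(b, x) \<in> parcs H" using universal[OF ab that(1)] sym by blast
      then show ?thesis using universal that by blast
    qed (use universal ab that in blast)
    then have "parcs H = {(u, v). (u, v) \<in> pverts H \<times> pverts H \<and> u \<noteq> v}"
      by (auto dest: H.in_arcsD1 H.in_arcsD2 simp: noloop)
    then show False
      using incomplete H.pair_finite_verts by (simp add: complete_digraph_pair_def)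
  qed
  then show thesis
    using that H.in_arcsD1 unfolding neighbourhood_def by blast
qed

section \<open>Paths\<close>

lemma card_even_less: "card {i. i < n \<and> even i} = Suc n div 2"
proof (induction n)
  case (Suc n)
  have "{i. i < Suc n \<and> even i} =
      (if even n then insert n {i. i < n \<and> even i} else {i. i < n \<and> even i})"
    by (auto simp: less_Suc_eq)
  then show ?case using Suc by auto
qed simp

lemma card_mod_three_less: "card {i. i < n \<and> i mod 3 \<noteq> 2} = n - n div 3"
proof (induction n)
  case (Suc n)
  have "{i. i < Suc n \<and> i mod 3 \<noteq> 2} =
      (if n mod 3 \<noteq> 2 then insert n {i. i < n \<and> i mod 3 \<noteq> 2} else {i. i < n \<and> i mod 3 \<noteq> 2})"
    by (auto simp: less_Suc_eq)
  moreover have "n div 3 \<le> n" by simp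
  ultimately show ?case using Suc by (simp add: div_Suc mod_Suc Suc_diff_le)
qed simp

lemma super_domination_number_path_lex_product_of_one_less:
  assumes H: "pair_graph H" and edge: "parcs H \<noteq> {}"
    and incomplete: "\<not> complete_digraph (card (pverts H)) (with_proj H)"
    and one: "super_domination_number H + 1 = card (pverts H)"
  shows "int (super_domination_number (lex_product (path_graph n) H)) =
    int n * int (card (pverts H)) - \<lceil>2 * real n / 3\<rceil>"
proof -
  interpret H: pair_graph H by fact
  note P = pair_graph_path_graph[of n]
  let ?L = "lex_product (path_graph n) H"
  have verts: "pverts ?L = {..<n} \<times> pverts H"
    by (simp add: lex_product_def path_graph_def)
  then have fin: "finite (pverts ?L)" and card_verts: "card (pverts ?L) = n * card (pverts H)"
    using H.pair_finite_verts by (simp_all add: card_cartesian_product)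
  obtain U where U: "privately_dominated ?L U"
      "card U + super_domination_number ?L = card (pverts ?L)"
    using ex_maximum_privately_dominated[OF fin] .
  obtain x w y where x: "x \<in> pverts H" "w \<in> pverts H" "x \<in> neighbourhood H w"
    and y: "y \<in> pverts H" "y \<noteq> x" "x \<notin> neighbourhood H y"
    using ex_vertex_neither_isolated_nor_universal[OF H edge incomplete] .
  define S where "S = {i. i < n \<and> i mod 3 \<noteq> 2}"
  \<comment> \<open>Layers \<open>3q\<close> and \<open>3q + 1\<close> serve each other. Only when the path ends with layer \<open>3q\<close> is there
    no partner; that layer has no neighbour in \<open>S\<close> and takes the first alternative.\<close>
  have "neighbourhood (path_graph n) i \<inter> S = {} \<or>
      (\<exists>j \<in> pverts (path_graph n). neighbourhood (path_graph n) j \<inter> S = {i})" if "i \<in> S" for i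
  proof -
    have i: "i < n" "i mod 3 \<noteq> 2" using that by (auto simp: S_def)
    define q where "q = i div 3"
    have "i mod 3 = 0 \<or> i mod 3 = 1" using i(2) mod_less_divisor[of 3 i] by auto
    then have "i = 3 * q \<or> i = 3 * q + 1"
      using mult_div_mod_eq[of 3 i] unfolding q_def by (metis add.right_neutral)
    moreover have gap: "j mod 3 = 2" if "3 * q = Suc j" for j
      using that by presburger
    ultimately consider "i = 3 * q + 1" | "i = 3 * q" "i + 1 < n" | "i = 3 * q" "i + 1 = n"
      using i(1) by fastforce
    then show ?thesis
    proof cases
      case 1
      then have "neighbourhood (path_graph n) (3 * q) \<inter> S = {i}"
        using i gap by (auto simp: S_def neighbourhood_path_graph)
      then show ?thesis using i(1) 1 by (auto simp: path_graph_def)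
    next
      case 2
      have "Suc (Suc (3 * q)) mod 3 = 2" by presburger
      then have "neighbourhood (path_graph n) (i + 1) \<inter> S = {i}"
        using i 2 by (auto simp: S_def neighbourhood_path_graph)
      then show ?thesis using 2(2) by (auto simp: path_graph_def)
    next
      case 3
      then have "neighbourhood (path_graph n) i \<inter> S = {}"
        using gap by (auto simp: S_def neighbourhood_path_graph)
      then show ?thesis by blast
    qed
  qed
  then have "privately_dominated ?L (S \<times> {x})"
    by (intro privately_dominated_lex_product_singleton_layers[OF P H _ _ x y])
      (auto simp: S_def path_graph_def)
  then have "card (S \<times> {x}) \<le> card U"
    using card_add_super_domination_number_le[OF fin] U(2) by fastforce
  then have lower: "n - n div 3 \<le> card U"
    by (simp add: card_cartesian_product S_def card_mod_three_less)
  have upper: "3 * card U \<le> 2 * n + 2"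
    by (rule three_mult_card_le_path_lex_product[OF H one U(1)])
  have "\<lceil>2 * real n / 3\<rceil> = int (card U)"
    using lower upper by (intro ceiling_unique) linarith+
  moreover have "int (card U) + int (super_domination_number ?L) = int n * int (card (pverts H))"
    using U(2) card_verts by (metis of_nat_add of_nat_mult)
  ultimately show ?thesis by linarith
qed

lemma super_domination_number_path_lex_product_of_two_less:
  assumes H: "pair_graph H" and k: "super_domination_number H + k = card (pverts H)" "2 \<le> k"
  shows "super_domination_number (lex_product (path_graph n) H) =
    (Suc n div 2) * super_domination_number H + card (pverts H) * (n div 2)"
proof -
  interpret H: pair_graph H by fact
  note P = pair_graph_path_graph[of n]
  let ?L = "lex_product (path_graph n) H"
  have verts: "pverts ?L = {..<n} \<times> pverts H"
    by (simp add: lex_product_def path_graph_def)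
  then have fin: "finite (pverts ?L)" and card_verts: "card (pverts ?L) = n * card (pverts H)"
    using H.pair_finite_verts by (simp_all add: card_cartesian_product)
  obtain U where U: "privately_dominated ?L U"
      "card U + super_domination_number ?L = card (pverts ?L)"
    using ex_maximum_privately_dominated[OF fin] .
  obtain W where W: "privately_dominated H W"
      "card W + super_domination_number H = card (pverts H)"
    using ex_maximum_privately_dominated[OF H.pair_finite_verts] .
  define S where "S = {i. i < n \<and> even i}"
  have "privately_dominated ?L (S \<times> W)"
    using W(1) by (intro privately_dominated_lex_product_independent P H)
      (auto simp: S_def path_graph_def neighbourhood_def)
  then have "card (S \<times> W) \<le> card U"
    using card_add_super_domination_number_le[OF fin] U(2) by fastforce
  moreover have "card W = k" using W(2) k(1) by simp
  ultimately have "(Suc n div 2) * k \<le> card U"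
    by (simp add: card_cartesian_product S_def card_even_less)
  moreover have "card U \<le> (Suc n div 2) * k"
    by (rule card_le_path_lex_product[OF H k U(1)])
  ultimately have "(Suc n div 2) * k + super_domination_number ?L = n * card (pverts H)"
    using U(2) card_verts by simp
  also have "n * card (pverts H) = (Suc n div 2 + n div 2) * card (pverts H)"
    by (rule arg_cong[where f = "\<lambda>m. m * card (pverts H)"]) presburger
  also have "\<dots> = (Suc n div 2) * k +
      ((Suc n div 2) * super_domination_number H + card (pverts H) * (n div 2))"
    by (simp add: algebra_simps flip: k(1))
  finally show ?thesis by simp
qed

theorem proposition21:
  fixes H :: "'a pair_pre_digraph" and n n' :: nat
  assumes "pair_graph H"
    and "parcs H \<noteq> {}"
    and "card (pverts H) = n'"
    and "n \<ge> 2"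
  shows "(int (super_domination_number H) = int n' - 1 \<and> \<not> complete_digraph n' (with_proj H) \<longrightarrow>
            int (super_domination_number (lex_product (path_graph n) H)) =
              int n * int n' - \<lceil>2 * real n / 3\<rceil>) \<and>
         (int (super_domination_number H) \<le> int n' - 2 \<longrightarrow>
            int (super_domination_number (lex_product (path_graph n) H)) =
              \<lceil>real n / 2\<rceil> * int (super_domination_number H) + int n' * \<lfloor>real n / 2\<rfloor>)"
proof (intro conjI impI)
  assume "int (super_domination_number H) = int n' - 1 \<and> \<not> complete_digraph n' (with_proj H)"
  then have one: "super_domination_number H + 1 = card (pverts H)"
    and incomplete: "\<not> complete_digraph (card (pverts H)) (with_proj H)"
    using assms(3) by auto
  show "int (super_domination_number (lex_product (path_graph n) H)) =
      int n * int n' - \<lceil>2 * real n / 3\<rceil>"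
    using super_domination_number_path_lex_product_of_one_less[OF assms(1,2) incomplete one]
      assms(3) by simp
next
  assume "int (super_domination_number H) \<le> int n' - 2"
  then obtain k where k: "super_domination_number H + k = card (pverts H)" "2 \<le> k"
    using assms(3) by (intro that[of "n' - super_domination_number H"]) auto
  have "\<lceil>real n / 2\<rceil> = int (Suc n div 2)" by (rule ceiling_unique) linarith+
  moreover have "\<lfloor>real n / 2\<rfloor> = int (n div 2)" by (rule floor_unique) linarith+
  ultimately show "int (super_domination_number (lex_product (path_graph n) H)) =
      \<lceil>real n / 2\<rceil> * int (super_domination_number H) + int n' * \<lfloor>real n / 2\<rfloor>"
    using super_domination_number_path_lex_product_of_two_less[OF assms(1) k, of n] assms(3)
    by simp
qed

end
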